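(* Let $f,\mathcal{U},\ell$ satisfy standing assumptions (A) and (B) of the context, let $V_d$ be the value functions generated by value iteration with $V_{-1}=0$, and let the stopping function $c_{\text{stop}}:\mathbb{R}^{n_\varepsilon}\times\mathbb{R}^n\to\mathbb{R}_{\geq 0}$ satisfy assumption (C) of the context. Let $\varepsilon\in\mathbb{R}^{n_\varepsilon}$. Then, for any $\Delta>0$, there exists $d\in\mathbb{Z}_{\geq 0}$ such that, for any $x\in\{z\in\mathbb{R}^n:\sigma(z)\leq\Delta\}$, $$V_d(x)-V_{d-1}(x)\leq c_{\text{stop}}(\varepsilon,x).$$ Moreover, when item (ii) of (C) holds with $L=\infty$, there exists $d\in\mathbb{Z}_{\geq 0}$ such that, for any $x\in\mathbb{R}^n$, $V_d(x)-V_{d-1}(x)\leq c_{\text{stop}}(\varepsilon,x)$.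
   Context: System and costs. Consider $x^+=f(x,u)$ with $x\in\mathbb{R}^n$, $u\in\mathcal{U}(x)\subseteq\mathbb{R}^m$, $f:\mathcal{W}\to\mathbb{R}^n$, $\mathcal{W}:=\{(x,u):x\in\mathbb{R}^n,u\in\mathcal{U}(x)\}$, and a stage cost $\ell:\mathcal{W}\to\mathbb{R}_{\geq 0}$. For an input sequence $\mathbf{u}=[u_0,u_1,\dots]$, $\phi(k,x,\mathbf{u}|_k)$ is the state at time $k$ starting from $x$ under the first $k$ inputs $\mathbf{u}|_k=[u_0,\dots,u_{k-1}]$, with $\phi(0,x,\mathbf{u}|_0)=x$; $\mathbf{u}$ is admissible if $u_k\in\mathcal{U}(\phi(k,x,\mathbf{u}|_k))$ for all $k$. Define $J_\infty(x,\mathbf{u}):=\sum_{k=0}^\infty \ell(\phi(k,x,\mathbf{u}|_k),u_k)$ and, for $\mathbf{u}_d=[u_0,\dots,u_d]$, $J_d(x,\mathbf{u}_d):=\sum_{k=0}^d\ell(\phi(k,x,\mathbf{u}_d|_k),u_k)$. A function $\mathbb{R}_{\geq 0}\to\mathbb{R}_{\geq 0}$ is of class $\mathcal{K}_\infty$ if it is continuous, zero at zero, strictly increasing and unbounded. (A) There exist $\overline{\alpha}_V,\alpha_W\in\mathcal{K}_\infty$ and a continuous $\sigma:\mathbb{R}^n\to\mathbb{R}_{\geq 0}$ such that: (i) for any $x\in\mathbb{R}^n$ there is an admissible infinite input sequence $\mathbf{u}^*_\infty(x)$ minimizing $J_\infty(x,\cdot)$, and $V_\infty(x):=J_\infty(x,\mathbf{u}^*_\infty(x))\leq\overline{\alpha}_V(\sigma(x))$;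 (ii) $\alpha_W(\sigma(x))\leq\ell(x,u)$ for any $(x,u)\in\mathcal{W}$. (B) For every $d\in\mathbb{Z}_{\geq 0}$ and $x\in\mathbb{R}^n$, the minimum $V_d(x):=\min_{\mathbf{u}_d}J_d(x,\mathbf{u}_d)$ over admissible $\mathbf{u}_d$ exists. Value iteration started from $V_{-1}=0$, i.e. $V_d(x)=\min_{u\in\mathcal{U}(x)}\{\ell(x,u)+V_{d-1}(f(x,u))\}$, generates exactly these $V_d$. (C) Assumption on $c_{\text{stop}}$ ($n_\varepsilon\geq 1$): one of the following holds. (i) For any $\varepsilon\in\mathbb{R}^{n_\varepsilon}$ there is $\underline\epsilon>0$ such that, for any $x\in\mathbb{R}^n$, $c_{\text{stop}}(\varepsilon,x)\geq\underline\epsilon$. (ii) There exist $L,\bar a_V,a_W>0$ (with $L=\infty$ permitted) such that (A) holds with $\overline{\alpha}_V(s)\leq\bar a_V s$ and $\alpha_W(s)\geq a_W s$ for any $s\in[0,L]$ (any $s\geq 0$ if $L=\infty$); furthermore, for any $\varepsilon\in\mathbb{R}^{n_\varepsilon}$ there is $\underline\epsilon>0$ such that, for any $x\in\mathbb{R}^n$, $c_{\text{stop}}(\varepsilon,x)\geq\underline\epsilon\,\sigma(x)$. *)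

theory Defs
  imports "HOL-Analysis.Analysis"
begin

text \<open>
  The dynamics \<open>f\<close> and the stage cost \<open>l\<close> are total functions of a state and an input;
  only their values at pairs \<open>(x, u)\<close> with \<open>u \<in> U x\<close> ever matter.
\<close>

type_synonym ('n, 'm) dynamics = "real^'n \<Rightarrow> real^'m \<Rightarrow> real^'n"
type_synonym ('n, 'm) constraint = "real^'n \<Rightarrow> (real^'m) set"
type_synonym ('n, 'm) stage_cost = "real^'n \<Rightarrow> real^'m \<Rightarrow> real"

text \<open>A function on the nonnegative reals is a real function, constrained on \<open>{0..}\<close> only;
  nonnegativity there follows from \<open>\<alpha> 0 = 0\<close> and monotonicity.\<close>

definition class_K_inf :: "(real \<Rightarrow> real) \<Rightarrow> bool" where
  "class_K_inf \<alpha> \<longleftrightarrow>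
     continuous_on {0..} \<alpha> \<and> \<alpha> 0 = 0 \<and> strict_mono_on {0..} \<alpha> \<and> \<not> bdd_above (\<alpha> ` {0..})"

text \<open>\<open>\<phi>(k, x, u|\<^sub>k)\<close> is \<open>state_after f x us\<close> for the list \<open>us\<close> of the first \<open>k\<close> inputs,
  so \<open>k\<close> is the length of \<open>us\<close>.\<close>

definition state_after ::
    "('n::finite, 'm::finite) dynamics \<Rightarrow> real^'n \<Rightarrow> (real^'m) list \<Rightarrow> real^'n" where
  "state_after f x us = foldl f x us"

definition admissible_inf ::
    "('n::finite, 'm::finite) dynamics \<Rightarrow> ('n, 'm) constraint \<Rightarrow> real^'n \<Rightarrow> (nat \<Rightarrow> real^'m) \<Rightarrow> bool"
  where
  "admissible_inf f U x u \<longleftrightarrow> (\<forall>k. u k \<in> U (state_after f x (map u [0..<k])))"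

text \<open>The infinite-horizon cost may be infinite, hence its type. The truncation of negative
  reals by \<^const>\<open>ennreal\<close> plays no role, as \<open>l\<close> is nonnegative along admissible sequences.\<close>

definition J_inf ::
    "('n::finite, 'm::finite) dynamics \<Rightarrow> ('n, 'm) stage_cost \<Rightarrow> real^'n \<Rightarrow> (nat \<Rightarrow> real^'m) \<Rightarrow> ennreal"
  where
  "J_inf f l x u = (\<Sum>k. ennreal (l (state_after f x (map u [0..<k])) (u k)))"

definition admissible_fin ::
    "('n::finite, 'm::finite) dynamics \<Rightarrow> ('n, 'm) constraint \<Rightarrow> real^'n \<Rightarrow> (real^'m) list \<Rightarrow> bool"
  where
  "admissible_fin f U x us \<longleftrightarrow> (\<forall>k<length us. us ! k \<in> U (state_after f x (take k us)))"

text \<open>The cost \<open>J\<^sub>d\<close> is \<open>J_fin\<close> on lists \<open>[u\<^sub>0, \<dots>, u\<^sub>d]\<close>, which have length \<open>d + 1\<close>.\<close>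

definition J_fin ::
    "('n::finite, 'm::finite) dynamics \<Rightarrow> ('n, 'm) stage_cost \<Rightarrow> real^'n \<Rightarrow> (real^'m) list \<Rightarrow> real"
  where
  "J_fin f l x us = (\<Sum>k<length us. l (state_after f x (take k us)) (us ! k))"

definition stabilizable_detectable ::
    "('n::finite, 'm::finite) dynamics \<Rightarrow> ('n, 'm) constraint \<Rightarrow> ('n, 'm) stage_cost \<Rightarrow>
     (real^'n \<Rightarrow> real) \<Rightarrow> (real \<Rightarrow> real) \<Rightarrow> (real \<Rightarrow> real) \<Rightarrow> bool" where
  "stabilizable_detectable f U l \<sigma> \<alpha>V \<alpha>W \<longleftrightarrow>
     class_K_inf \<alpha>V \<and> class_K_inf \<alpha>W \<and>
     continuous_on UNIV \<sigma> \<and> (\<forall>x. 0 \<le> \<sigma> x) \<and>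
     (\<forall>x. \<exists>u. is_arg_min (J_inf f l x) (admissible_inf f U x) u \<and>
              J_inf f l x u \<le> ennreal (\<alpha>V (\<sigma> x))) \<and>
     (\<forall>x. \<forall>u\<in>U x. \<alpha>W (\<sigma> x) \<le> l x u)"

definition finite_horizon_minima_exist ::
    "('n::finite, 'm::finite) dynamics \<Rightarrow> ('n, 'm) constraint \<Rightarrow> ('n, 'm) stage_cost \<Rightarrow> bool" where
  "finite_horizon_minima_exist f U l \<longleftrightarrow>
     (\<forall>(d::nat) x. \<exists>us.
        is_arg_min (J_fin f l x) (\<lambda>us. length us = d + 1 \<and> admissible_fin f U x us) us)"

text \<open>\<open>VI_iterate j\<close> is the result of \<open>j\<close> value iteration steps from the zero function.
  \<^const>\<open>Least\<close> is the minimum of the set of values, whenever that minimum exists.\<close>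

primrec VI_iterate ::
    "('n::finite, 'm::finite) dynamics \<Rightarrow> ('n, 'm) constraint \<Rightarrow> ('n, 'm) stage_cost \<Rightarrow>
     nat \<Rightarrow> real^'n \<Rightarrow> real" where
  "VI_iterate f U l 0 = (\<lambda>x. 0)"
| "VI_iterate f U l (Suc j) =
     (\<lambda>x. LEAST v. \<exists>u\<in>U x. v = l x u + VI_iterate f U l j (f x u))"

text \<open>\<open>V\<^sub>d\<close> for \<open>d \<ge> -1\<close>, with \<open>V\<^sub>-\<^sub>1 = 0\<close>; indices below \<open>-1\<close> are not used.\<close>

definition VI_value ::
    "('n::finite, 'm::finite) dynamics \<Rightarrow> ('n, 'm) constraint \<Rightarrow> ('n, 'm) stage_cost \<Rightarrow>
     int \<Rightarrow> real^'n \<Rightarrow> real" where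
  "VI_value f U l d = VI_iterate f U l (nat (d + 1))"

definition stopping_uniform :: "(real^'e::finite \<Rightarrow> real^'n::finite \<Rightarrow> real) \<Rightarrow> bool" where
  "stopping_uniform c_stop \<longleftrightarrow> (\<forall>\<epsilon>. \<exists>\<delta>>0. \<forall>x. c_stop \<epsilon> x \<ge> \<delta>)"

text \<open>The comparison functions with linear bounds on \<open>[0, L]\<close> are existentially quantified for
  the given \<open>\<sigma>\<close>; for \<open>L = \<infinity>\<close> the bounds hold for all \<open>s \<ge> 0\<close>.\<close>

definition stopping_linear ::
    "('n::finite, 'm::finite) dynamics \<Rightarrow> ('n, 'm) constraint \<Rightarrow> ('n, 'm) stage_cost \<Rightarrow>
     (real^'n \<Rightarrow> real) \<Rightarrow> (real^'e::finite \<Rightarrow> real^'n \<Rightarrow> real) \<Rightarrow> ereal \<Rightarrow> bool" where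
  "stopping_linear f U l \<sigma> c_stop L \<longleftrightarrow>
     (\<exists>aV>0. \<exists>aW>0. \<exists>\<alpha>V \<alpha>W.
        stabilizable_detectable f U l \<sigma> \<alpha>V \<alpha>W \<and>
        (\<forall>s\<ge>0. ereal s \<le> L \<longrightarrow> \<alpha>V s \<le> aV * s \<and> \<alpha>W s \<ge> aW * s)) \<and>
     (\<forall>\<epsilon>. \<exists>\<delta>>0. \<forall>x. c_stop \<epsilon> x \<ge> \<delta> * \<sigma> x)"

end

theory Submission
  imports Defs
begin

text \<open>
  Write \<open>W\<^sub>j\<close> for the \<open>j\<close>-th iterate, so that \<open>V\<^sub>d = W\<^sub>d\<^sub>+\<^sub>1\<close>. Following an optimal trajectory for
  horizon \<open>d\<close> up to a visited state \<open>y\<close> and re-optimizing from there with one more step gives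
  \<open>W\<^sub>d\<^sub>+\<^sub>1 x - W\<^sub>d x \<le> W\<^sub>j\<^sub>+\<^sub>1 y - W\<^sub>j y \<le> \<alpha>V (\<sigma> y)\<close>, where \<open>j\<close> is the number of remaining steps.
  The stage costs along this trajectory sum up to \<open>W\<^sub>d x \<le> \<alpha>V (\<sigma> x)\<close>, so one of the \<open>d\<close> visited
  states satisfies \<open>\<alpha>W (\<sigma> y) \<le> \<alpha>V (\<sigma> x) / d\<close>. For large \<open>d\<close> this makes \<open>\<alpha>V (\<sigma> y)\<close> smaller than any
  constant, by continuity at zero, and smaller than any multiple of \<open>\<sigma> x\<close>, under linear bounds.
\<close>

section \<open>Dynamic programming\<close>

lemma J_fin_Nil [simp]: "J_fin f l x [] = 0"
  by (simp add: J_fin_def)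

lemma J_fin_Cons [simp]: "J_fin f l x (u # us) = l x u + J_fin f l (f x u) us"
  unfolding J_fin_def length_Cons sum.lessThan_Suc_shift by (simp add: state_after_def)

lemma admissible_fin_Nil [simp]: "admissible_fin f U x []"
  by (simp add: admissible_fin_def)

lemma admissible_fin_Cons [simp]:
  "admissible_fin f U x (u # us) \<longleftrightarrow> u \<in> U x \<and> admissible_fin f U (f x u) us"
  by (simp add: admissible_fin_def state_after_def All_less_Suc2)

lemma take_map_upt: "k \<le> d \<Longrightarrow> take k (map u [0..<d]) = map u [0..<k]"
  by (simp add: take_map)

lemma admissible_inf_imp_fin:
  assumes "admissible_inf f U x u"
  shows "admissible_fin f U x (map u [0..<d])"
  using assms by (simp add: admissible_inf_def admissible_fin_def take_map_upt)

lemma J_fin_le_J_inf: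
  assumes nonneg: "\<forall>x. \<forall>u\<in>U x. 0 \<le> l x u"
    and adm: "admissible_inf f U x u"
  shows "ennreal (J_fin f l x (map u [0..<d])) \<le> J_inf f l x u"
proof -
  let ?c = "\<lambda>k. l (state_after f x (map u [0..<k])) (u k)"
  have "J_fin f l x (map u [0..<d]) = (\<Sum>k<d. ?c k)"
    by (simp add: J_fin_def take_map_upt)
  also have "ennreal \<dots> = (\<Sum>k<d. ennreal (?c k))"
    using adm nonneg by (intro sum_ennreal [symmetric]) (auto simp: admissible_inf_def)
  also have "\<dots> \<le> J_inf f l x u"
    unfolding J_inf_def by (intro sum_le_suminf) auto
  finally show ?thesis .
qed

text \<open>An attained minimum over input lists of length \<open>j\<close>, kept as a relation so
  that existence remains a separate question. Horizon 0, with only the empty list, is included and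
  matches the zero iterate.\<close>

definition is_horizon_value ::
    "('n::finite, 'm::finite) dynamics \<Rightarrow> ('n, 'm) constraint \<Rightarrow> ('n, 'm) stage_cost \<Rightarrow>
     nat \<Rightarrow> real^'n \<Rightarrow> real \<Rightarrow> bool" where
  "is_horizon_value f U l j x v \<longleftrightarrow>
     (\<exists>us. length us = j \<and> admissible_fin f U x us \<and> J_fin f l x us = v) \<and>
     (\<forall>us. length us = j \<longrightarrow> admissible_fin f U x us \<longrightarrow> v \<le> J_fin f l x us)"

lemma is_horizon_value_exists:
  assumes "finite_horizon_minima_exist f U l"
  shows "\<exists>v. is_horizon_value f U l (Suc j) x v"
proof -
  obtain us where
    "is_arg_min (J_fin f l x) (\<lambda>us. length us = j + 1 \<and> admissible_fin f U x us) us"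
    using assms unfolding finite_horizon_minima_exist_def by blast
  then have "is_horizon_value f U l (Suc j) x (J_fin f l x us)"
    by (auto simp: is_horizon_value_def is_arg_min_linorder)
  then show ?thesis ..
qed

text \<open>Bellman's principle: prepending \<open>u\<close> to an optimal tail gives a candidate,
  and cutting the head off an optimal list leaves a candidate tail.\<close>

lemma is_horizon_value_Suc:
  assumes W: "\<And>y. is_horizon_value f U l j y (W y)"
    and v: "is_horizon_value f U l (Suc j) x v"
  shows "\<exists>u\<in>U x. v = l x u + W (f x u)"
    and "\<And>u. u \<in> U x \<Longrightarrow> v \<le> l x u + W (f x u)"
proof -
  show le: "v \<le> l x u + W (f x u)" if "u \<in> U x" for u
  proof -
    obtain us where "length us = j" "admissible_fin f U (f x u) us" "J_fin f l (f x u) us = W (f x u)"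
      using W unfolding is_horizon_value_def by blast
    then have "length (u # us) = Suc j" "admissible_fin f U x (u # us)"
      "J_fin f l x (u # us) = l x u + W (f x u)"
      using that by auto
    then show ?thesis
      using v unfolding is_horizon_value_def by metis
  qed
  obtain us where us: "length us = Suc j" "admissible_fin f U x us" "J_fin f l x us = v"
    using v unfolding is_horizon_value_def by blast
  then obtain u us' where "us = u # us'"
    by (auto simp: length_Suc_conv)
  then have us': "length us' = j" "u \<in> U x" "admissible_fin f U (f x u) us'"
    "l x u + J_fin f l (f x u) us' = v"
    using us by auto
  then have "W (f x u) \<le> J_fin f l (f x u) us'"
    using W unfolding is_horizon_value_def by blast
  then have "v = l x u + W (f x u)"
    using us' le by fastforce
  then show "\<exists>u\<in>U x. v = l x u + W (f x u)"
    using us' by blast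
qed

text \<open>The minimizer over whole lists attains the one-step minimum as well, so the
  \<open>LEAST\<close> in the iteration is a genuine minimum.\<close>

lemma is_horizon_value_VI_iterate:
  assumes "finite_horizon_minima_exist f U l"
  shows "is_horizon_value f U l j x (VI_iterate f U l j x)"
proof (induction j arbitrary: x)
  case 0
  show ?case by (simp add: is_horizon_value_def)
next
  case (Suc j)
  obtain v where v: "is_horizon_value f U l (Suc j) x v"
    using is_horizon_value_exists [OF assms] by blast
  have "VI_iterate f U l (Suc j) x = v"
    unfolding VI_iterate.simps
    using is_horizon_value_Suc [OF Suc v] by (intro Least_equality) auto
  then show ?case using v by simp
qed

lemmas VI_iterate_Suc_attained =
  is_horizon_value_Suc(1) [OF is_horizon_value_VI_iterate is_horizon_value_VI_iterate]

lemmas VI_iterate_Suc_le =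
  is_horizon_value_Suc(2) [OF is_horizon_value_VI_iterate is_horizon_value_VI_iterate]

lemma VI_iterate_nonneg:
  assumes nonneg: "\<forall>x. \<forall>u\<in>U x. 0 \<le> l x u"
    and B: "finite_horizon_minima_exist f U l"
  shows "0 \<le> VI_iterate f U l j x"
proof (induction j arbitrary: x)
  case (Suc j)
  obtain u where "u \<in> U x" "VI_iterate f U l (Suc j) x = l x u + VI_iterate f U l j (f x u)"
    using VI_iterate_Suc_attained [OF B B] by blast
  then show ?case
    using Suc nonneg by simp
qed simp

section \<open>Increments of value iteration\<close>

lemma class_K_inf_nonneg:
  assumes "class_K_inf \<alpha>" "0 \<le> s"
  shows "0 \<le> \<alpha> s"
  using assms strict_mono_on_leD [of "{0..}" \<alpha> 0 s] by (auto simp: class_K_inf_def)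

lemma class_K_inf_le_iff:
  assumes "class_K_inf \<alpha>" "0 \<le> s" "0 \<le> t"
  shows "\<alpha> s \<le> \<alpha> t \<longleftrightarrow> s \<le> t"
  using assms strict_mono_on_less_eq [of "{0..}" \<alpha> s t] by (auto simp: class_K_inf_def)

lemma class_K_inf_small_near_0:
  assumes "class_K_inf \<alpha>" "0 < \<delta>"
  shows "\<exists>\<eta>>0. \<alpha> \<eta> \<le> \<delta>"
proof -
  obtain e where e: "0 < e" "\<And>s. 0 \<le> s \<Longrightarrow> dist s 0 < e \<Longrightarrow> dist (\<alpha> s) (\<alpha> 0) < \<delta>"
    using assms unfolding class_K_inf_def continuous_on_iff by (metis atLeast_iff order_refl)
  then have "dist (\<alpha> (e / 2)) (\<alpha> 0) < \<delta>"
    by (simp add: dist_real_def)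
  then have "\<alpha> (e / 2) \<le> \<delta>"
    using assms(1) by (simp add: class_K_inf_def dist_real_def)
  then show ?thesis
    using e(1) by (intro exI [of _ "e / 2"]) simp
qed

text \<open>The first \<open>j\<close> inputs of the infinite-horizon minimizer are a candidate for
  horizon \<open>j\<close>, and dropping the tail only lowers the cost.\<close>

lemma VI_iterate_le:
  assumes nonneg: "\<forall>x. \<forall>u\<in>U x. 0 \<le> l x u"
    and A: "stabilizable_detectable f U l \<sigma> \<alpha>V \<alpha>W"
    and B: "finite_horizon_minima_exist f U l"
  shows "VI_iterate f U l j x \<le> \<alpha>V (\<sigma> x)"
proof -
  obtain u where u: "admissible_inf f U x u" "J_inf f l x u \<le> ennreal (\<alpha>V (\<sigma> x))"
    using A unfolding stabilizable_detectable_def is_arg_min_def by metis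
  have "0 \<le> \<alpha>V (\<sigma> x)"
    using A by (simp add: stabilizable_detectable_def class_K_inf_nonneg)
  then have "J_fin f l x (map u [0..<j]) \<le> \<alpha>V (\<sigma> x)"
    using order_trans [OF J_fin_le_J_inf [OF nonneg u(1)] u(2)] by simp
  moreover have "VI_iterate f U l j x \<le> J_fin f l x (map u [0..<j])"
    using is_horizon_value_VI_iterate [OF B] admissible_inf_imp_fin [OF u(1)]
    by (simp add: is_horizon_value_def)
  ultimately show ?thesis by simp
qed

text \<open>A pigeonhole argument by induction on the horizon: \<open>real d * c\<close> is a budget
  that \<open>d\<close> stages of cost at least \<open>c\<close> would exhaust, so the optimal
  trajectory must meet a cheap state.\<close>

lemma VI_increment_le:
  assumes nonneg: "\<forall>x. \<forall>u\<in>U x. 0 \<le> l x u"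
    and A: "stabilizable_detectable f U l \<sigma> \<alpha>V \<alpha>W"
    and B: "finite_horizon_minima_exist f U l"
    and "VI_iterate f U l d x < real d * c"
  shows "\<exists>y. \<alpha>W (\<sigma> y) < c \<and> VI_iterate f U l (Suc d) x - VI_iterate f U l d x \<le> \<alpha>V (\<sigma> y)"
  using assms(4)
proof (induction d arbitrary: x)
  case 0
  then show ?case by simp
next
  case (Suc d)
  show ?case
  proof (cases "\<alpha>W (\<sigma> x) < c")
    case True
    then show ?thesis
      \<comment> \<open>Here \<open>x\<close> itself is the cheap state; the subtracted iterate is
        nonnegative.\<close>
      using VI_iterate_le [OF nonneg A B, of "Suc (Suc d)" x]
        VI_iterate_nonneg [OF nonneg B, of "Suc d" x]
      by (intro exI [of _ x]) linarith
  next
    case False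
    obtain u where u: "u \<in> U x"
      "VI_iterate f U l (Suc d) x = l x u + VI_iterate f U l d (f x u)"
      using VI_iterate_Suc_attained [OF B B] by blast
    have "c \<le> l x u"
      using False u(1) A unfolding stabilizable_detectable_def by fastforce
    \<comment> \<open>The first stage uses up at least one share \<open>c\<close> of the
      budget.\<close>
    then have "VI_iterate f U l d (f x u) < real d * c"
      using Suc.prems u(2) by (simp add: algebra_simps del: VI_iterate.simps)
    then obtain y where "\<alpha>W (\<sigma> y) < c"
      "VI_iterate f U l (Suc d) (f x u) - VI_iterate f U l d (f x u) \<le> \<alpha>V (\<sigma> y)"
      using Suc.IH by blast
    then show ?thesis
      \<comment> \<open>\<open>u\<close> is optimal for the shorter horizon and merely a candidate
        for the longer one, so the increment at \<open>x\<close> is at most that at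
        \<open>f x u\<close>.\<close>
      using VI_iterate_Suc_le [OF B B u(1), of "Suc d"] u(2)
      by (intro exI [of _ y]) linarith
  qed
qed

text \<open>\<open>\<alpha>V \<Delta>\<close> bounds all iterates on the sublevel set at once, so
  one \<open>N\<close> serves every \<open>x\<close> in it.\<close>

lemma VI_increment_le_const:
  assumes nonneg: "\<forall>x. \<forall>u\<in>U x. 0 \<le> l x u"
    and A: "stabilizable_detectable f U l \<sigma> \<alpha>V \<alpha>W"
    and B: "finite_horizon_minima_exist f U l"
    and "0 < \<delta>"
  shows "\<exists>N. \<forall>d\<ge>N. \<forall>x. \<sigma> x \<le> \<Delta> \<longrightarrow> VI_iterate f U l (Suc d) x - VI_iterate f U l d x \<le> \<delta>"
proof -
  have K: "class_K_inf \<alpha>V" "class_K_inf \<alpha>W" and \<sigma>: "\<And>x. 0 \<le> \<sigma> x"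
    using A by (auto simp: stabilizable_detectable_def)
  obtain \<eta> where \<eta>: "0 < \<eta>" "\<alpha>V \<eta> \<le> \<delta>"
    using class_K_inf_small_near_0 [OF K(1) \<open>0 < \<delta>\<close>] by blast
  \<comment> \<open>With this threshold, \<open>\<alpha>W (\<sigma> y) < c\<close> forces
    \<open>\<sigma> y\<close> below \<open>\<eta>\<close>.\<close>
  define c where "c = \<alpha>W \<eta>"
  have "0 < c"
    using class_K_inf_le_iff [OF K(2), of \<eta> 0] \<eta>(1) K(2) by (auto simp: c_def class_K_inf_def)
  then obtain N :: nat where N: "\<alpha>V \<Delta> < real N * c"
    using reals_Archimedean3 by blast
  have "VI_iterate f U l (Suc d) x - VI_iterate f U l d x \<le> \<delta>" if "N \<le> d" "\<sigma> x \<le> \<Delta>" for d x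
  proof -
    have "VI_iterate f U l d x \<le> \<alpha>V (\<sigma> x)"
      by (rule VI_iterate_le [OF nonneg A B])
    also have "\<dots> \<le> \<alpha>V \<Delta>"
      using class_K_inf_le_iff [OF K(1) \<sigma>, of \<Delta> x] that(2) \<sigma> [of x] by simp
    also have "\<dots> < real d * c"
      using N \<open>0 < c\<close> that(1) by (smt (verit) mult_right_mono of_nat_le_iff)
    finally obtain y where y: "\<alpha>W (\<sigma> y) < c"
      "VI_iterate f U l (Suc d) x - VI_iterate f U l d x \<le> \<alpha>V (\<sigma> y)"
      using VI_increment_le [OF nonneg A B] by blast
    have "\<sigma> y \<le> \<eta>"
      using y(1) class_K_inf_le_iff [OF K(2) \<sigma>, of \<eta> y] \<eta>(1) by (simp add: c_def)
    then have "\<alpha>V (\<sigma> y) \<le> \<alpha>V \<eta>"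
      using class_K_inf_le_iff [OF K(1) \<sigma>, of \<eta> y] \<eta>(1) by simp
    then show ?thesis
      using y(2) \<eta>(2) by linarith
  qed
  then show ?thesis by blast
qed

text \<open>The cost bound and the budget both scale with \<open>\<sigma> x\<close>, which cancels;
  hence \<open>N\<close> is uniform even on an unbounded range.\<close>

lemma VI_increment_le_linear:
  assumes nonneg: "\<forall>x. \<forall>u\<in>U x. 0 \<le> l x u"
    and A: "stabilizable_detectable f U l \<sigma> \<alpha>V \<alpha>W"
    and B: "finite_horizon_minima_exist f U l"
    and pos: "0 < \<delta>" "0 < aV" "0 < aW"
    and lin: "\<And>s. 0 \<le> s \<Longrightarrow> ereal s \<le> L \<Longrightarrow> \<alpha>V s \<le> aV * s \<and> aW * s \<le> \<alpha>W s"
  shows "\<exists>N. \<forall>d\<ge>N. \<forall>x. ereal (\<sigma> x) \<le> L \<longrightarrow>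
           VI_iterate f U l (Suc d) x - VI_iterate f U l d x \<le> \<delta> * \<sigma> x"
proof -
  have K: "class_K_inf \<alpha>V" "class_K_inf \<alpha>W" and \<sigma>: "\<And>x. 0 \<le> \<sigma> x"
    using A by (auto simp: stabilizable_detectable_def)
  \<comment> \<open>The bound \<open>t \<le> 1\<close> keeps the visited state \<open>y\<close> below in the range of the linear bounds.\<close>
  define t where "t = min 1 (\<delta> / aV)"
  have t: "0 < t" "t \<le> 1" "aV * t \<le> \<delta>"
    using pos by (auto simp: t_def min_def field_simps)
  then obtain N :: nat where N: "aV < real N * (t * aW)"
    using pos reals_Archimedean3 [of "t * aW"] by auto
  have "VI_iterate f U l (Suc d) x - VI_iterate f U l d x \<le> \<delta> * \<sigma> x"
    if "N \<le> d" "ereal (\<sigma> x) \<le> L" for d x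
  \<comment> \<open>At \<open>\<sigma> x = 0\<close> the strict budget inequality fails, but
    \<open>\<alpha>V 0 = 0\<close> already bounds the increment.\<close>
  proof (cases "\<sigma> x = 0")
    case True
    then show ?thesis
      using VI_iterate_le [OF nonneg A B, of "Suc d" x] K(1)
        VI_iterate_nonneg [OF nonneg B, of d x]
      by (simp add: class_K_inf_def del: VI_iterate.simps)
  next
    case False
    then have "0 < \<sigma> x" using \<sigma> [of x] by simp
    have "VI_iterate f U l d x \<le> aV * \<sigma> x"
      using VI_iterate_le [OF nonneg A B, of d x] lin [OF \<sigma> that(2)] by linarith
    also have "aV < real d * (t * aW)"
      using N that(1) t(1) pos(3)
      by (smt (verit) mult_pos_pos mult_right_mono of_nat_le_iff)
    then have "aV * \<sigma> x < real d * (t * aW * \<sigma> x)"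
      using \<open>0 < \<sigma> x\<close> by (metis mult.assoc mult_strict_right_mono)
    finally obtain y where y: "\<alpha>W (\<sigma> y) < t * aW * \<sigma> x"
      "VI_iterate f U l (Suc d) x - VI_iterate f U l d x \<le> \<alpha>V (\<sigma> y)"
      using VI_increment_le [OF nonneg A B] by blast
    have "t * aW * \<sigma> x \<le> aW * \<sigma> x"
      using t(2) pos(3) \<open>0 < \<sigma> x\<close> by simp
    also have "\<dots> \<le> \<alpha>W (\<sigma> x)"
      using lin [OF \<sigma> that(2)] by simp
    \<comment> \<open>A first, crude comparison: it makes the linear bounds available at
      \<open>y\<close>, and only then can the sharper factor \<open>t\<close> be extracted.\<close>
    finally have "\<sigma> y \<le> \<sigma> x"
      using y(1) class_K_inf_le_iff [OF K(2) \<sigma> \<sigma>, of y x] by simp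
    then have "ereal (\<sigma> y) \<le> L"
      using that(2) by (meson ereal_less_eq(3) order_trans)
    then have lin_y: "\<alpha>V (\<sigma> y) \<le> aV * \<sigma> y" "aW * \<sigma> y \<le> \<alpha>W (\<sigma> y)"
      using lin \<sigma> by auto
    then have "aW * \<sigma> y \<le> aW * (t * \<sigma> x)"
      using y(1) by (simp add: mult_ac)
    then have "\<sigma> y \<le> t * \<sigma> x"
      using pos(3) by simp
    then have "aV * \<sigma> y \<le> aV * t * \<sigma> x"
      using pos(2) by (simp add: mult.assoc)
    also have "\<dots> \<le> \<delta> * \<sigma> x"
      using t(3) \<sigma> by (intro mult_right_mono)
    finally show ?thesis
      using y(2) lin_y(1) by linarith
  qed
  then show ?thesis by blast
qed

section \<open>From increments to the stopping test\<close>

lemma VI_increment_le_stopping_linear: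
  assumes nonneg: "\<forall>x. \<forall>u\<in>U x. 0 \<le> l x u"
    and B: "finite_horizon_minima_exist f U l"
    and S: "stopping_linear f U l \<sigma> c_stop L"
  shows "\<exists>N. \<forall>d\<ge>N. \<forall>x. ereal (\<sigma> x) \<le> L \<longrightarrow>
           VI_iterate f U l (Suc d) x - VI_iterate f U l d x \<le> c_stop \<epsilon> x"
proof -
  obtain aV aW \<alpha>V \<alpha>W where *: "0 < aV" "0 < aW" "stabilizable_detectable f U l \<sigma> \<alpha>V \<alpha>W"
    "\<And>s. 0 \<le> s \<Longrightarrow> ereal s \<le> L \<Longrightarrow> \<alpha>V s \<le> aV * s \<and> aW * s \<le> \<alpha>W s"
    using S unfolding stopping_linear_def by blast
  obtain \<delta> where \<delta>: "0 < \<delta>" "\<And>x. \<delta> * \<sigma> x \<le> c_stop \<epsilon> x"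
    using S unfolding stopping_linear_def by blast
  show ?thesis
    using VI_increment_le_linear [OF nonneg *(3) B \<delta>(1) *(1,2,4)] \<delta>(2)
    by (meson order_trans)
qed

lemma VI_value_increment:
  "VI_value f U l (int d) x - VI_value f U l (int d - 1) x =
   VI_iterate f U l (Suc d) x - VI_iterate f U l d x"
proof -
  \<comment> \<open>The shift by one covers \<open>d = 0\<close> too: index -1 is the zero
    iterate.\<close>
  have "nat (int d + 1) = Suc d" "nat (int d - 1 + 1) = d" by auto
  then show ?thesis by (simp only: VI_value_def)
qed

theorem theorem2:
  fixes f :: "('n::finite, 'm::finite) dynamics"
    and U :: "('n, 'm) constraint"
    and l :: "('n, 'm) stage_cost"
    and \<sigma> :: "real^'n \<Rightarrow> real"
    and \<alpha>V \<alpha>W :: "real \<Rightarrow> real"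
    and c_stop :: "real^'e::finite \<Rightarrow> real^'n \<Rightarrow> real"
    and \<epsilon> :: "real^'e"
  assumes cost_nonneg: "\<And>x u. u \<in> U x \<Longrightarrow> 0 \<le> l x u"
    and A: "stabilizable_detectable f U l \<sigma> \<alpha>V \<alpha>W"
    and B: "finite_horizon_minima_exist f U l"
    and stop_nonneg: "\<And>e x. 0 \<le> c_stop e x"
    and C: "stopping_uniform c_stop \<or> (\<exists>L>0. stopping_linear f U l \<sigma> c_stop L)"
  shows "(\<forall>\<Delta>>0. \<exists>d::nat. \<forall>x\<in>{z. \<sigma> z \<le> \<Delta>}.
            VI_value f U l (int d) x - VI_value f U l (int d - 1) x \<le> c_stop \<epsilon> x) \<and>
         (stopping_linear f U l \<sigma> c_stop \<infinity> \<longrightarrow>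
            (\<exists>d::nat. \<forall>x.
               VI_value f U l (int d) x - VI_value f U l (int d - 1) x \<le> c_stop \<epsilon> x))"
proof -
  let ?D = "\<lambda>d x. VI_iterate f U l (Suc d) x - VI_iterate f U l d x"
  have nonneg: "\<forall>x. \<forall>u\<in>U x. 0 \<le> l x u"
    using cost_nonneg by blast
  note const = VI_increment_le_const [OF nonneg A B]
  note linear = VI_increment_le_stopping_linear [OF nonneg B]
  have "\<exists>d. \<forall>x. \<sigma> x \<le> \<Delta> \<longrightarrow> ?D d x \<le> c_stop \<epsilon> x" for \<Delta>
    using C
  proof (elim disjE exE conjE)
    assume "stopping_uniform c_stop"
    then obtain \<delta> where "0 < \<delta>" "\<And>x. \<delta> \<le> c_stop \<epsilon> x"
      unfolding stopping_uniform_def by blast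
    then show ?thesis
      using const [of \<delta> \<Delta>] by (meson order_refl order_trans)
  next
    fix L assume "0 < L" and S: "stopping_linear f U l \<sigma> c_stop L"
    \<comment> \<open>A finite positive level is needed since \<open>L\<close> may be
      infinite.\<close>
    obtain r where r: "0 < r" "ereal r \<le> L"
      using \<open>0 < L\<close> by (metis ereal_dense2 ereal_less(2) order_less_imp_le)
    obtain \<delta> where \<delta>: "0 < \<delta>" "\<And>x. \<delta> * \<sigma> x \<le> c_stop \<epsilon> x"
      using S unfolding stopping_linear_def by blast
    obtain N where N: "\<And>d x. N \<le> d \<Longrightarrow> ereal (\<sigma> x) \<le> L \<Longrightarrow> ?D d x \<le> c_stop \<epsilon> x"
      using linear [OF S] by blast
    obtain M where M: "\<And>d x. M \<le> d \<Longrightarrow> \<sigma> x \<le> \<Delta> \<Longrightarrow> ?D d x \<le> \<delta> * r"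
      using const [of "\<delta> * r" \<Delta>] \<delta>(1) r(1) by auto
    \<comment> \<open>Up to \<open>L\<close> the linear bound applies; beyond it
      \<open>\<sigma> x\<close> is at least \<open>r\<close>, so the constant
      \<open>\<delta> * r\<close> lies below \<open>c_stop\<close>.\<close>
    have "?D (max M N) x \<le> c_stop \<epsilon> x" if "\<sigma> x \<le> \<Delta>" for x
    proof (cases "ereal (\<sigma> x) \<le> L")
      case True
      then show ?thesis using N by simp
    next
      case False
      then have "ereal r \<le> ereal (\<sigma> x)"
        using r(2) by (meson linorder_linear order_trans)
      then have "\<delta> * r \<le> \<delta> * \<sigma> x"
        using \<delta>(1) by simp
      then show ?thesis
        using M [OF _ that, of "max M N"] \<delta>(2) [of x] by linarith
    qed
    then show ?thesis by blast
  qed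
  moreover have "\<exists>d. \<forall>x. ?D d x \<le> c_stop \<epsilon> x" if "stopping_linear f U l \<sigma> c_stop \<infinity>"
    \<comment> \<open>For \<open>L = \<infinity>\<close> the range condition is vacuous, so
      \<open>N\<close> itself serves as \<open>d\<close>.\<close>
    using linear [OF that, of \<epsilon>] by auto
  ultimately show ?thesis
    unfolding VI_value_increment by blast
qed

end
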